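(* Let $V=\mathbb Z^d$, and let $\{\eta(t),t\ge0\}$ on $\Omega=E^V$ be dual to a discrete particle system $\{\xi(t),t\ge0\}$ on finite configurations $\xi\in\hat\Omega$ (with $\hat E\subset\mathbb N$), with factorized duality function $D(\xi,\eta)=\prod_{x\in V}d(\xi_x,\eta_x)$ satisfying $d(0,\cdot)\equiv1$. Assume that the dual process conserves the number of particles and satisfies bounded harmonic triviality. Let $\mu$ be a probability measure on $\Omega$ such that the uniform domination property of $D$ w.r.t. $\mu$ holds. Consider the statements: (a) $\mu$ is a stationary product measure for the process $\{\eta(t),t\ge0\}$; (b) for all finite configurations $\xi\in\hat\Omega$ and all $x\in V$, $$\int D(\xi,\eta)\,\mu(d\eta)=\left(\int D(\delta_x,\eta)\,\mu(d\eta)\right)^{|\xi|}.$$ Then (a) implies (b). Moreover, if $d$ is measure determining, then (a) and (b) are equivalent.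
   Context: $E$ is one of $\mathbb N=\{0,1,\dots\}$, $\{0,\dots,N\}$ with $N\ge1$, or $\mathbb R_+=[0,\infty)$; $\hat E$ is $\mathbb N$ or $\{0,\dots,N\}$ with $N\ge1$. A configuration $\xi\in\hat E^V$ is finite if $|\xi|:=\sum_{x\in V}\xi_x<\infty$; for such $\xi$ the product defining $D(\xi,\eta)$ has only finitely many factors different from $1$. $\delta_x$ is the configuration with a single particle at $x$ and none elsewhere. Duality with (measurable) duality function $D$ means: for all $t>0$, all finite $\xi\in\hat\Omega$ and all $\eta\in\Omega$, $\hat{\mathbb E}_\xi D(\xi(t),\eta)=\mathbb E_\eta D(\xi,\eta(t))$. Bounded harmonic triviality of the dual process: if $H$ is a bounded function on finite configurations with $\hat{\mathbb E}_\xi H(\xi(t))=H(\xi)$ for all $t>0$ and all finite $\xi$, then $H(\xi)=\psi(|\xi|)$ for some bounded function $\psi:\mathbb N\to\mathbb R$. Uniform domination property of $D$ w.r.t. $\mu$: for all $n\in\mathbb N$ there exists a $\mu$-integrable function $f_n$ such that $\sup_{\xi\in\hat\Omega,\,|\xi|=n}|D(\xi,\eta)|\le f_n(\eta)$ for all $\eta\in\Omega$. A product measure is a measure of the form $\otimes_{x\in V}\nu_x$ with $\nu_x$ probability measures on $E$. The function $d:\hat E\times E\to\mathbb R$ is measure determining if, for any two probability measures $\nu_\ast,\nu_\star$ on $E$ such that $\int_E d(k,s)\,\nu_\ast(ds)=\int_E d(k,s)\,\nu_\star(ds)<\infty$ for all $k\in\hat E$, it follows that $\nu_\ast=\nu_\star$.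 *)

theory Defs
  imports "HOL-Probability.Probability" "HOL-Library.Groups_Big_Fun"
begin

section \<open>Markov processes\<close>

text \<open>
  A Markov process on the state space \<open>S\<close>, given by coordinates \<open>X t\<close> on a sample space \<open>W\<close> and
  the laws \<open>P \<eta>\<close> on \<open>W\<close> of the process started from \<open>\<eta>\<close>.  No regularity of
  paths and no topology on \<open>S\<close> is assumed.
\<close>

definition history :: "'s measure \<Rightarrow> 'w measure \<Rightarrow> (real \<Rightarrow> 'w \<Rightarrow> 's) \<Rightarrow> real \<Rightarrow> 'w measure" where
  "history S W X s =
     sigma (space W) {X u -` B \<inter> space W |u B. 0 \<le> u \<and> u \<le> s \<and> B \<in> sets S}"

locale markov_process =
  fixes S :: "'s measure" and W :: "'w measure"
    and P :: "'s \<Rightarrow> 'w measure" and X :: "real \<Rightarrow> 'w \<Rightarrow> 's"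
  assumes kernel: "P \<in> measurable S (prob_algebra W)"
    and coordinate: "\<And>t. 0 \<le> t \<Longrightarrow> X t \<in> measurable W S"
    and start: "\<And>\<eta>. \<eta> \<in> space S \<Longrightarrow> distr (P \<eta>) S (X 0) = return S \<eta>"
    and markov: "\<And>\<eta> s t A B. \<lbrakk>\<eta> \<in> space S; 0 \<le> s; 0 \<le> t; A \<in> sets (history S W X s); B \<in> sets S\<rbrakk> \<Longrightarrow>
      measure (P \<eta>) {w \<in> A. X (s + t) w \<in> B} =
        (\<integral>w. indicator A w * measure (P (X s w)) {w' \<in> space W. X t w' \<in> B} \<partial>P \<eta>)"

text \<open>Here \<open>\<mu> \<bind> P\<close> is the law of the process started from the random initial state \<open>\<mu>\<close>.\<close>

definition stationary ::
  "'s measure \<Rightarrow> ('s \<Rightarrow> 'w measure) \<Rightarrow> (real \<Rightarrow> 'w \<Rightarrow> 's) \<Rightarrow> 's measure \<Rightarrow> bool" where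
  "stationary S P X \<mu> \<longleftrightarrow> (\<forall>t\<ge>0. distr (\<mu> \<bind> P) S (X t) = \<mu>)"

text \<open>
  Duality of the process \<open>X'\<close> on \<open>S'\<close> and the process \<open>X\<close> on \<open>S\<close>.
  The integrability clauses say that the two expectations exist; without them the Bochner integral
  would be 0 by convention.  The state space \<open>S'\<close> will be countable and discrete, so
  that measurability of \<open>D\<close> is measurability in its second argument.
\<close>

definition dual_processes ::
  "'r measure \<Rightarrow> ('r \<Rightarrow> 'v measure) \<Rightarrow> (real \<Rightarrow> 'v \<Rightarrow> 'r) \<Rightarrow>
   's measure \<Rightarrow> ('s \<Rightarrow> 'w measure) \<Rightarrow> (real \<Rightarrow> 'w \<Rightarrow> 's) \<Rightarrow> ('r \<Rightarrow> 's \<Rightarrow> real) \<Rightarrow> bool" where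
  "dual_processes S' P' X' S P X D \<longleftrightarrow>
     (\<forall>\<xi>\<in>space S'. D \<xi> \<in> borel_measurable S) \<and>
     (\<forall>t>0. \<forall>\<xi>\<in>space S'. \<forall>\<eta>\<in>space S.
        integrable (P' \<xi>) (\<lambda>w. D (X' t w) \<eta>) \<and>
        integrable (P \<eta>) (\<lambda>w. D \<xi> (X t w)) \<and>
        (\<integral>w. D (X' t w) \<eta> \<partial>P' \<xi>) = (\<integral>w. D \<xi> (X t w) \<partial>P \<eta>))"


section \<open>Configurations\<close>

definition site_space :: "real set \<Rightarrow> real measure" where
  "site_space E = restrict_space borel E"

definition config_space :: "real set \<Rightarrow> ('a \<Rightarrow> real) measure" where
  "config_space E = (\<Pi>\<^sub>M x\<in>UNIV. site_space E)"

definition particles :: "('a \<Rightarrow> nat) \<Rightarrow> nat" where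
  "particles \<xi> = (\<Sum>\<^sub>\<infinity>x\<in>UNIV. \<xi> x)"

text \<open>Summability is taken in the discrete space \<^typ>\<open>nat\<close>; see \<open>nat_summable_on_iff\<close>.\<close>

definition finite_configs :: "nat set \<Rightarrow> ('a \<Rightarrow> nat) set" where
  "finite_configs Ehat = {\<xi>. (\<forall>x. \<xi> x \<in> Ehat) \<and> \<xi> summable_on UNIV}"

definition delta_config :: "'a \<Rightarrow> 'a \<Rightarrow> nat" where
  "delta_config x = (\<lambda>y. if y = x then 1 else 0)"

lemma nat_summable_on_iff:
  fixes \<xi> :: "'a \<Rightarrow> nat"
  shows "\<xi> summable_on UNIV \<longleftrightarrow> finite {x. \<xi> x \<noteq> 0}"
proof
  assume "\<xi> summable_on UNIV"
  then obtain s where "(sum \<xi> \<longlongrightarrow> s) (finite_subsets_at_top UNIV)"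
    by (auto simp: summable_on_def has_sum_def)
  then have "eventually (\<lambda>F. sum \<xi> F = s) (finite_subsets_at_top UNIV)"
    by (simp add: tendsto_discrete)
  then obtain F where F: "finite F" "\<And>G. finite G \<Longrightarrow> F \<subseteq> G \<Longrightarrow> sum \<xi> G = s"
    by (auto simp: eventually_finite_subsets_at_top)
  have "x \<in> F" if "\<xi> x \<noteq> 0" for x
  proof (rule ccontr)
    assume "x \<notin> F"
    moreover have "sum \<xi> (insert x F) = sum \<xi> F"
      using F(2)[of F] F(2)[of "insert x F"] F(1) by (simp only: subset_insertI order_refl finite_insert)
    ultimately show False using F(1) that by simp
  qed
  then have "{x. \<xi> x \<noteq> 0} \<subseteq> F" by (simp only: subset_eq mem_Collect_eq) simp
  then show "finite {x. \<xi> x \<noteq> 0}" using F(1) finite_subset by blast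
next
  assume "finite {x. \<xi> x \<noteq> 0}"
  then have "\<xi> summable_on {x. \<xi> x \<noteq> 0}" by (rule summable_on_finite)
  moreover have "\<xi> summable_on {x. \<xi> x \<noteq> 0} \<longleftrightarrow> \<xi> summable_on UNIV"
    by (rule summable_on_cong_neutral) simp_all
  ultimately show "\<xi> summable_on UNIV" by blast
qed

lemma particles_eq_sum:
  assumes "finite {x. \<xi> x \<noteq> 0}"
  shows "particles \<xi> = (\<Sum>x | \<xi> x \<noteq> 0. \<xi> x)"
proof -
  have "infsum \<xi> UNIV = infsum \<xi> {x. \<xi> x \<noteq> 0}"
    by (rule infsum_cong_neutral) simp_all
  then show ?thesis using assms by (simp add: particles_def)
qed


section \<open>Assumptions on the dual process and on the duality function\<close>

definition conserves_particles ::
  "('a \<Rightarrow> nat) set \<Rightarrow> (('a \<Rightarrow> nat) \<Rightarrow> 'w measure) \<Rightarrow> (real \<Rightarrow> 'w \<Rightarrow> 'a \<Rightarrow> nat) \<Rightarrow> bool" where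
  "conserves_particles C P X \<longleftrightarrow>
     (\<forall>t\<ge>0. \<forall>\<xi>\<in>C. AE w in P \<xi>. particles (X t w) = particles \<xi>)"

definition bounded_harmonic_triviality ::
  "('a \<Rightarrow> nat) set \<Rightarrow> (('a \<Rightarrow> nat) \<Rightarrow> 'w measure) \<Rightarrow> (real \<Rightarrow> 'w \<Rightarrow> 'a \<Rightarrow> nat) \<Rightarrow> bool" where
  "bounded_harmonic_triviality C P X \<longleftrightarrow>
     (\<forall>H :: ('a \<Rightarrow> nat) \<Rightarrow> real.
        bounded (H ` C) \<and> (\<forall>t>0. \<forall>\<xi>\<in>C. (\<integral>w. H (X t w) \<partial>P \<xi>) = H \<xi>) \<longrightarrow>
        (\<exists>\<psi> :: nat \<Rightarrow> real. bounded (range \<psi>) \<and> (\<forall>\<xi>\<in>C. H \<xi> = \<psi> (particles \<xi>))))"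

text \<open>
  \<^const>\<open>Prod_any\<close> multiplies the factors different from 1; these are finitely many for finite \<open>\<xi>\<close>
  when \<open>d 0 = 1\<close> on the single-site space.
\<close>

definition factorized :: "(nat \<Rightarrow> real \<Rightarrow> real) \<Rightarrow> ('a \<Rightarrow> nat) \<Rightarrow> ('a \<Rightarrow> real) \<Rightarrow> real" where
  "factorized d \<xi> \<eta> = Prod_any (\<lambda>x. d (\<xi> x) (\<eta> x))"

definition uniform_domination ::
  "('a \<Rightarrow> nat) set \<Rightarrow> ('a \<Rightarrow> real) measure \<Rightarrow> (('a \<Rightarrow> nat) \<Rightarrow> ('a \<Rightarrow> real) \<Rightarrow> real) \<Rightarrow> bool" where
  "uniform_domination C \<mu> D \<longleftrightarrow>
     (\<forall>n. \<exists>f :: ('a \<Rightarrow> real) \<Rightarrow> real. integrable \<mu> f \<and>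
        (\<forall>\<eta>\<in>space \<mu>. (SUP \<xi>\<in>{\<xi> \<in> C. particles \<xi> = n}. ereal \<bar>D \<xi> \<eta>\<bar>) \<le> ereal (f \<eta>)))"

definition product_measure :: "real set \<Rightarrow> ('a \<Rightarrow> real) measure \<Rightarrow> bool" where
  "product_measure E \<mu> \<longleftrightarrow>
     (\<exists>\<nu> :: 'a \<Rightarrow> real measure.
        (\<forall>x. prob_space (\<nu> x) \<and> sets (\<nu> x) = sets (site_space E)) \<and>
        \<mu> = (\<Pi>\<^sub>M x\<in>UNIV. \<nu> x))"

definition measure_determining :: "nat set \<Rightarrow> real set \<Rightarrow> (nat \<Rightarrow> real \<Rightarrow> real) \<Rightarrow> bool" where
  "measure_determining Ehat E d \<longleftrightarrow>
     (\<forall>\<nu>1 \<nu>2. prob_space \<nu>1 \<and> sets \<nu>1 = sets (site_space E) \<and>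
        prob_space \<nu>2 \<and> sets \<nu>2 = sets (site_space E) \<and>
        (\<forall>k\<in>Ehat. integrable \<nu>1 (d k) \<and> integrable \<nu>2 (d k) \<and>
           (\<integral>s. d k s \<partial>\<nu>1) = (\<integral>s. d k s \<partial>\<nu>2)) \<longrightarrow>
        \<nu>1 = \<nu>2)"

end

theory Submission
  imports Defs
begin

text \<open>
  The domination is required at every configuration and there are infinitely many sites, so each
  \<open>d k\<close> is bounded and no integrability question remains.  Fubini and duality turn the integral of
  \<open>D \<xi>\<close> under the law at time \<open>t\<close> into the dual expectation of \<open>H (\<xi> t)\<close>, where \<open>H \<xi>\<close> is the
  \<open>\<mu>\<close>-integral of \<open>D \<xi>\<close>.  For stationary \<open>\<mu>\<close> the restriction of \<open>H\<close> to \<open>n\<close> particles is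
  therefore bounded harmonic, hence constant, and the \<open>n\<close> particles may be spread over distinct
  sites, where a product measure factorizes.  Conversely, (b) is inherited by the law at every time
  \<open>t\<close>, and moments of the form \<open>c ^ particles \<xi>\<close> characterize a single product measure, by replacing
  one factor \<open>d k\<close> at a time by the indicator of a measurable set.
\<close>

section \<open>Integration against kernels and infinite product measures\<close>

text \<open>\<open>nn_integral_bind\<close> handles non-negative integrands. Under probability
  measures, adding the constant \<open>B\<close> shifts every integral by exactly \<open>B\<close>,
  so the identity for \<open>f\<close> follows from the one for the non-negative function
  \<open>f + B\<close>.\<close>

lemma integral_bind_bounded:
  fixes f :: "'b \<Rightarrow> real"
  assumes "prob_space M" and N: "N \<in> measurable M (prob_algebra K)"
    and f: "f \<in> borel_measurable K" and B: "\<And>y. y \<in> space K \<Longrightarrow> \<bar>f y\<bar> \<le> B"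
  shows "(\<integral>y. f y \<partial>(M \<bind> N)) = (\<integral>x. \<integral>y. f y \<partial>N x \<partial>M)"
proof -
  interpret M: prob_space M by fact
  have N': "N \<in> measurable M (subprob_algebra K)"
    using N by (rule measurable_prob_algebraD)
  have Nx: "prob_space (N x)" "sets (N x) = sets K" if "x \<in> space M" for x
    using measurable_space[OF N that] by (auto simp: space_prob_algebra)
  have "M \<in> space (prob_algebra M)" by (simp add: space_prob_algebra M.prob_space_axioms)
  then have MN: "prob_space (M \<bind> N)" "sets (M \<bind> N) = sets K"
    using prob_space_bind'[OF _ N] sets_bind'[OF _ N] by simp_all
  have Bpos: "0 \<le> f y + B" if "y \<in> space K" for y using B[OF that] by linarith
  \<comment> \<open>Stated for an arbitrary probability measure \<open>Q\<close> on
    \<open>K\<close>, because it serves each \<open>N x\<close> as well as the mixture of all of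
    them.\<close>
  have shift: "ennreal (integral\<^sup>L Q f + B) = (\<integral>\<^sup>+y. ennreal (f y + B) \<partial>Q)"
      "integrable Q f" "\<bar>integral\<^sup>L Q f\<bar> \<le> B"
    if Q: "prob_space Q" "sets Q = sets K" for Q
  proof -
    interpret Q: prob_space Q by fact
    have sp: "space Q = space K" using Q(2) by (rule sets_eq_imp_space_eq)
    show int: "integrable Q f"
      by (rule Q.integrable_const_bound[where B=B])
        (use f B sp in \<open>auto simp: measurable_cong_sets[OF Q(2) refl]\<close>)
    have "(\<integral>\<^sup>+y. ennreal (f y + B) \<partial>Q) = ennreal (\<integral>y. f y + B \<partial>Q)"
      by (rule nn_integral_eq_integral) (use int Bpos sp in \<open>auto intro!: AE_I2\<close>)
    then show "ennreal (integral\<^sup>L Q f + B) = (\<integral>\<^sup>+y. ennreal (f y + B) \<partial>Q)"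
      using int by (simp add: Q.prob_space)
    have "\<bar>integral\<^sup>L Q f\<bar> \<le> (\<integral>y. \<bar>f y\<bar> \<partial>Q)" by (rule integral_abs_bound)
    also have "\<dots> \<le> (\<integral>y. B \<partial>Q)"
      by (rule integral_mono) (use int B sp in auto)
    finally show "\<bar>integral\<^sup>L Q f\<bar> \<le> B" by (simp add: Q.prob_space)
  qed
  define h where "h x = (\<integral>y. f y \<partial>N x)" for x
  have h: "h \<in> borel_measurable M"
    unfolding h_def by (rule measurable_compose[OF N' integral_measurable_subprob_algebra[OF f]])
  have hB: "\<bar>h x\<bar> \<le> B" if "x \<in> space M" for x
    unfolding h_def by (rule shift(3)[OF Nx[OF that]])
  have hpos: "0 \<le> h x + B" and hlow: "- B \<le> h x" if "x \<in> space M" for x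
    using hB[OF that] by linarith+
  have hint: "integrable M h"
    by (rule M.integrable_const_bound[where B=B]) (use h hB in auto)
  have "ennreal (integral\<^sup>L (M \<bind> N) f + B) = (\<integral>\<^sup>+y. ennreal (f y + B) \<partial>(M \<bind> N))"
    by (rule shift(1)[OF MN])
  also have "\<dots> = (\<integral>\<^sup>+x. \<integral>\<^sup>+y. ennreal (f y + B) \<partial>N x \<partial>M)"
    by (rule nn_integral_bind[OF _ N']) (use f in measurable)
  also have "\<dots> = (\<integral>\<^sup>+x. ennreal (h x + B) \<partial>M)"
    unfolding h_def by (intro nn_integral_cong) (simp add: shift(1)[OF Nx])
  also have "\<dots> = ennreal (\<integral>x. h x + B \<partial>M)"
    by (rule nn_integral_eq_integral) (use hint hpos in \<open>auto intro!: AE_I2\<close>)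
  also have "(\<integral>x. h x + B \<partial>M) = integral\<^sup>L M h + B"
    using hint by (simp add: M.prob_space)
  finally have "ennreal (integral\<^sup>L (M \<bind> N) f + B) = ennreal (integral\<^sup>L M h + B)" .
  \<comment> \<open>Cancelling \<open>ennreal\<close> on both sides requires both arguments to be
    non-negative.\<close>
  moreover have "0 \<le> integral\<^sup>L (M \<bind> N) f + B" using shift(3)[OF MN] by linarith
  moreover have "0 \<le> integral\<^sup>L M h + B"
  proof -
    have "(\<integral>x. - B \<partial>M) \<le> integral\<^sup>L M h"
      by (rule integral_mono) (use hint hlow in auto)
    then show ?thesis by (simp add: M.prob_space)
  qed
  ultimately show ?thesis unfolding h_def by (simp add: ennreal_inj)
qed

text \<open>The integrand sees only the coordinates in \<open>F\<close>, and the marginal of the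
  infinite product on \<open>F\<close> is the finite product, where integrals of products of
  one-coordinate functions factorize.\<close>

lemma integral_prod_PiM:
  fixes f :: "'i \<Rightarrow> 'b \<Rightarrow> real"
  assumes "\<And>i. prob_space (M i)" and "finite F" and f: "\<And>i. i \<in> F \<Longrightarrow> integrable (M i) (f i)"
  shows "(\<integral>\<omega>. (\<Prod>i\<in>F. f i (\<omega> i)) \<partial>PiM UNIV M) = (\<Prod>i\<in>F. integral\<^sup>L (M i) (f i))"
proof -
  interpret product_prob_space M UNIV
    using assms(1) by (intro product_prob_spaceI) auto
  have meas: "(\<lambda>\<omega>. \<Prod>i\<in>F. f i (\<omega> i)) \<in> borel_measurable (PiM F M)"
    by (rule borel_measurable_prod)
      (use f in \<open>auto intro: measurable_compose[OF measurable_component_singleton]\<close>)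
  have "(\<Prod>i\<in>F. integral\<^sup>L (M i) (f i)) = (\<integral>\<omega>. (\<Prod>i\<in>F. f i (\<omega> i)) \<partial>PiM F M)"
    by (rule product_integral_prod[symmetric]) (use assms in auto)
  also have "PiM F M = distr (PiM UNIV M) (PiM F M) (\<lambda>\<omega>. restrict \<omega> F)"
    using assms(2) by (simp add: distr_PiM_restrict_finite)
  also have "(\<integral>\<omega>. (\<Prod>i\<in>F. f i (\<omega> i)) \<partial>\<dots>) = (\<integral>\<omega>. (\<Prod>i\<in>F. f i (restrict \<omega> F i)) \<partial>PiM UNIV M)"
    by (rule integral_distr[OF _ meas]) (rule measurable_restrict_subset, simp)
  also have "\<dots> = (\<integral>\<omega>. (\<Prod>i\<in>F. f i (\<omega> i)) \<partial>PiM UNIV M)"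
    by (intro Bochner_Integration.integral_cong prod.cong) auto
  finally show ?thesis by simp
qed

section \<open>Configurations and evaluation of the duality function\<close>

lemma space_site_space [simp]: "space (site_space E) = E"
  by (simp add: site_space_def space_restrict_space)

lemma mem_space_config: "\<eta> \<in> space (config_space E) \<longleftrightarrow> (\<forall>x. \<eta> x \<in> E)"
  by (auto simp: config_space_def space_PiM)

lemma measurable_coordinate: "(\<lambda>\<eta>. \<eta> x) \<in> measurable (config_space E) (site_space E)"
  unfolding config_space_def by (rule measurable_component_singleton) simp

lemma finite_configs_iff:
  "\<xi> \<in> finite_configs Ehat \<longleftrightarrow> (\<forall>x. \<xi> x \<in> Ehat) \<and> finite {x. \<xi> x \<noteq> 0}"
  by (simp add: finite_configs_def nat_summable_on_iff)

lemma particles_eq_sum_superset: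
  assumes "finite F" "{x. \<xi> x \<noteq> 0} \<subseteq> F"
  shows "particles \<xi> = sum \<xi> F"
proof -
  have "finite {x. \<xi> x \<noteq> 0}" using assms finite_subset by blast
  then show ?thesis
    using assms by (auto simp: particles_eq_sum intro: sum.mono_neutral_left)
qed

text \<open>A finite configuration is determined by its graph over the support, which is a finite
  subset of a countable set. Countability later gives joint measurability in the dual configuration
  and \<open>\<eta>\<close>.\<close>

lemma countable_finite_configs: "countable (finite_configs Ehat :: ('a::countable \<Rightarrow> nat) set)"
proof -
  define gr where "gr \<xi> = {(x, \<xi> x) |x. \<xi> x \<noteq> 0}" for \<xi> :: "'a \<Rightarrow> nat"
  have "inj gr"
  proof (rule injI, rule ext)
    fix \<xi> \<zeta> :: "'a \<Rightarrow> nat" and x assume eq: "gr \<xi> = gr \<zeta>"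
    have "(x, k) \<in> gr \<xi> \<longleftrightarrow> (x, k) \<in> gr \<zeta>" for k by (simp add: eq)
    then have "(k = \<xi> x \<and> \<xi> x \<noteq> 0) \<longleftrightarrow> (k = \<zeta> x \<and> \<zeta> x \<noteq> 0)" for k by (simp add: gr_def)
    then show "\<xi> x = \<zeta> x" by metis
  qed
  moreover have "gr ` finite_configs Ehat \<subseteq> {A. finite A}"
    by (auto simp: gr_def finite_configs_iff Setcompr_eq_image)
  then have "countable (gr ` finite_configs Ehat)"
    using countable_Collect_finite countable_subset by blast
  ultimately show ?thesis using countable_image_inj_on inj_on_subset by blast
qed

text \<open>With all particles on one site the duality function reduces to the single factor
  \<open>d k\<close>; this turns information about \<open>D\<close> into information about
  \<open>d\<close> and about one-site marginals.\<close>

definition pile :: "nat \<Rightarrow> 'a \<Rightarrow> 'a \<Rightarrow> nat" where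
  "pile k x = (\<lambda>y. if y = x then k else 0)"

lemma delta_config_eq_pile: "delta_config x = pile 1 x"
  unfolding delta_config_def pile_def by (rule refl)

lemma particles_pile [simp]: "particles (pile k x) = k"
  by (subst particles_eq_sum_superset[of "{x}"]) (auto simp: pile_def)

lemma factorized_eq_prod:
  assumes d0: "\<And>s. s \<in> E \<Longrightarrow> d 0 s = 1" and \<eta>: "\<eta> \<in> space (config_space E)"
    and F: "finite F" "{x. \<xi> x \<noteq> 0} \<subseteq> F"
  shows "factorized d \<xi> \<eta> = (\<Prod>x\<in>F. d (\<xi> x) (\<eta> x))"
  unfolding factorized_def
proof (rule Prod_any.expand_superset[OF F(1)])
  have "d (\<xi> x) (\<eta> x) = 1" if "\<xi> x = 0" for x
    using d0 \<eta> that by (simp add: mem_space_config)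
  then show "{x. d (\<xi> x) (\<eta> x) \<noteq> 1} \<subseteq> F" using F(2) by blast
qed

section \<open>Bounded single-site factors\<close>

text \<open>Domination refers to one particular measure, whereas boundedness of each
  \<open>d k\<close> refers to none. It therefore gives integrability under every probability
  measure, in particular under the law of the process at a later time and under one-site
  marginals.\<close>

locale bounded_factor =
  fixes E :: "real set" and Ehat :: "nat set" and d :: "nat \<Rightarrow> real \<Rightarrow> real"
  assumes zero_mem: "0 \<in> Ehat" and one_mem: "1 \<in> Ehat"
    and d_0: "s \<in> E \<Longrightarrow> d 0 s = 1"
    and d_measurable: "k \<in> Ehat \<Longrightarrow> d k \<in> borel_measurable (site_space E)"
    and d_bounded: "k \<in> Ehat \<Longrightarrow> \<exists>M. \<forall>s\<in>E. \<bar>d k s\<bar> \<le> M"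
begin

lemma pile_mem: "k \<in> Ehat \<Longrightarrow> pile k x \<in> finite_configs Ehat"
  using zero_mem by (auto simp: finite_configs_iff pile_def)

lemmas factorized_eq = factorized_eq_prod[where d=d and E=E, OF d_0]

lemma factorized_pile:
  "\<eta> \<in> space (config_space E) \<Longrightarrow> factorized d (pile k x) \<eta> = d k (\<eta> x)"
  by (subst factorized_eq[where F="{x}"]) (auto simp: pile_def)

lemma factorized_measurable:
  assumes "\<xi> \<in> finite_configs Ehat"
  shows "factorized d \<xi> \<in> borel_measurable (config_space E)"
proof -
  have "(\<lambda>\<eta>. \<Prod>x | \<xi> x \<noteq> 0. d (\<xi> x) (\<eta> x)) \<in> borel_measurable (config_space E)"
    by (rule borel_measurable_prod)
      (use assms in \<open>auto simp: finite_configs_iff intro: measurable_compose[OF measurable_coordinate d_measurable]\<close>)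
  then show ?thesis
    using assms by (subst measurable_cong[OF factorized_eq]) (auto simp: finite_configs_iff)
qed

text \<open>With \<open>n\<close> particles at most \<open>n\<close> sites are occupied, each by at
  most \<open>n\<close> particles. So there are at most \<open>n\<close> nontrivial factors, all
  taken from finitely many bounded functions \<open>d k\<close>.\<close>

lemma factorized_bounded:
  obtains B where "\<And>\<xi> \<eta>. \<xi> \<in> finite_configs Ehat \<Longrightarrow> particles \<xi> = n \<Longrightarrow>
    \<eta> \<in> space (config_space E) \<Longrightarrow> \<bar>factorized d \<xi> \<eta>\<bar> \<le> B"
proof -
  obtain M where M: "\<And>k s. k \<in> Ehat \<Longrightarrow> s \<in> E \<Longrightarrow> \<bar>d k s\<bar> \<le> M k" using d_bounded by metis
  \<comment> \<open>The summand 1 ensures \<open>1 \<le> K\<close>, so that powers of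
    \<open>K\<close> increase with the exponent; the absolute values avoid a sign condition on
    \<open>M\<close>.\<close>
  define K where "K = 1 + (\<Sum>k\<le>n. \<bar>M k\<bar>)"
  have K1: "1 \<le> K" by (simp add: K_def sum_nonneg)
  have MK: "M k \<le> K" if "k \<le> n" for k
    using member_le_sum[of k "{..n}" "\<lambda>k. \<bar>M k\<bar>"] that by (simp add: K_def)
  have "\<bar>factorized d \<xi> \<eta>\<bar> \<le> K ^ n"
    if \<xi>: "\<xi> \<in> finite_configs Ehat" "particles \<xi> = n" and \<eta>: "\<eta> \<in> space (config_space E)" for \<xi> \<eta>
  proof -
    define S where "S = {x. \<xi> x \<noteq> 0}"
    have S: "finite S" "sum \<xi> S = n"
      using \<xi> by (auto simp: S_def finite_configs_iff particles_eq_sum)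
    have le: "\<bar>d (\<xi> x) (\<eta> x)\<bar> \<le> K" if "x \<in> S" for x
    proof -
      have "\<xi> x \<le> n" using member_le_sum[of x S \<xi>] S that by simp
      moreover have "\<bar>d (\<xi> x) (\<eta> x)\<bar> \<le> M (\<xi> x)"
        using \<xi> \<eta> by (intro M) (auto simp: finite_configs_iff mem_space_config)
      ultimately show ?thesis using MK by fastforce
    qed
    have "factorized d \<xi> \<eta> = (\<Prod>x\<in>S. d (\<xi> x) (\<eta> x))"
      using S(1) \<eta> by (intro factorized_eq) (auto simp: S_def)
    then have "\<bar>factorized d \<xi> \<eta>\<bar> \<le> (\<Prod>x\<in>S. K)"
      using prod_mono[of S "\<lambda>x. \<bar>d (\<xi> x) (\<eta> x)\<bar>" "\<lambda>_. K"] le by (simp add: abs_prod)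
    also have "\<dots> \<le> K ^ n"
    proof -
      \<comment> \<open>Every occupied site holds at least one particle.\<close>
      have "card S \<le> sum \<xi> S" using sum_mono[of S "\<lambda>_. 1" \<xi>] by (force simp: S_def)
      then show ?thesis using S(2) K1 by (simp add: power_increasing)
    qed
    finally show ?thesis .
  qed
  then show ?thesis by (rule that)
qed

lemma integrable_factorized:
  assumes "prob_space M" "sets M = sets (config_space E)" "\<xi> \<in> finite_configs Ehat"
  shows "integrable M (factorized d \<xi>)"
proof -
  interpret prob_space M by fact
  obtain B where "\<And>\<eta>. \<eta> \<in> space (config_space E) \<Longrightarrow> \<bar>factorized d \<xi> \<eta>\<bar> \<le> B"
    using factorized_bounded[of "particles \<xi>"] assms(3) by metis
  then show ?thesis
    using factorized_measurable[OF assms(3)] sets_eq_imp_space_eq[OF assms(2)]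
    by (intro integrable_const_bound[where B=B]) (auto simp: measurable_cong_sets[OF assms(2) refl])
qed

lemma integrable_d:
  assumes "prob_space \<nu>" "sets \<nu> = sets (site_space E)" "k \<in> Ehat"
  shows "integrable \<nu> (d k)"
proof -
  interpret prob_space \<nu> by fact
  obtain B where "\<forall>s\<in>E. \<bar>d k s\<bar> \<le> B" using d_bounded[OF assms(3)] by blast
  then show ?thesis
    using d_measurable[OF assms(3)] sets_eq_imp_space_eq[OF assms(2)]
    by (intro integrable_const_bound[where B=B]) (auto simp: measurable_cong_sets[OF assms(2) refl])
qed

section \<open>Product measures and their moments\<close>

lemma integral_factorized_PiM:
  assumes \<nu>: "\<And>x. prob_space (\<nu> x)" "\<And>x. sets (\<nu> x) = sets (site_space E)"
    and \<xi>: "\<And>x. \<xi> x \<in> Ehat" and F: "finite F" "{x. \<xi> x \<noteq> 0} \<subseteq> F"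
  shows "(\<integral>\<eta>. factorized d \<xi> \<eta> \<partial>PiM UNIV \<nu>) = (\<Prod>x\<in>F. \<integral>s. d (\<xi> x) s \<partial>\<nu> x)"
proof -
  have "sets (PiM UNIV \<nu>) = sets (config_space E)"
    unfolding config_space_def by (intro sets_PiM_cong) (auto simp: \<nu>)
  then have "space (PiM UNIV \<nu>) = space (config_space E)" by (rule sets_eq_imp_space_eq)
  then have "(\<integral>\<eta>. factorized d \<xi> \<eta> \<partial>PiM UNIV \<nu>) = (\<integral>\<eta>. (\<Prod>x\<in>F. d (\<xi> x) (\<eta> x)) \<partial>PiM UNIV \<nu>)"
    using F by (intro Bochner_Integration.integral_cong factorized_eq) auto
  also have "\<dots> = (\<Prod>x\<in>F. \<integral>s. d (\<xi> x) s \<partial>\<nu> x)"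
    using \<nu> \<xi> F by (intro integral_prod_PiM) (auto intro: integrable_d)
  finally show ?thesis .
qed

text \<open>The signed weight \<open>U\<close> is reduced to probability measures by comparing the laws of \<open>X\<close> under the
  densities \<open>1 + U / B\<close> and \<open>1\<close>.\<close>

lemma weighted_measure_determining:
  fixes U :: "'b \<Rightarrow> real"
  assumes det: "measure_determining Ehat E d" and M: "prob_space M"
    and X: "X \<in> measurable M (site_space E)" and U: "U \<in> borel_measurable M"
    and UB: "\<And>w. w \<in> space M \<Longrightarrow> \<bar>U w\<bar> \<le> B"
    and zero: "\<And>k. k \<in> Ehat \<Longrightarrow> (\<integral>w. d k (X w) * U w \<partial>M) = 0"
    and A: "A \<in> sets (site_space E)"
  shows "(\<integral>w. indicator A (X w) * U w \<partial>M) = 0"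
proof -
  interpret prob_space M by fact
  note X[measurable] U[measurable] A[measurable]
  \<comment> \<open>A bound for \<open>U\<close> that is strictly positive, so that division by
    \<open>C\<close> is legitimate and \<open>1 + U / C\<close> is non-negative.\<close>
  define C where "C = \<bar>B\<bar> + 1"
  have C: "0 < C" "\<And>w. w \<in> space M \<Longrightarrow> \<bar>U w\<bar> \<le> C" using UB by (force simp: C_def)+
  define g where "g w = 1 + U w / C" for w
  have g[measurable]: "g \<in> borel_measurable M" unfolding g_def by measurable
  have g0: "0 \<le> g w" if "w \<in> space M" for w
    using C(1) C(2)[OF that] by (auto simp: g_def field_simps abs_le_iff)
  define Q where "Q = density M (\<lambda>w. ennreal (g w))"
  have XE: "X w \<in> E" if "w \<in> space M" for w using measurable_space[OF X that] by simp
  have intU: "integrable M (\<lambda>w. f (X w) * U w)" "integrable M (\<lambda>w. f (X w))"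
    if f[measurable]: "f \<in> borel_measurable (site_space E)" and fM: "\<And>s. s \<in> E \<Longrightarrow> \<bar>f s\<bar> \<le> K"
    for f :: "real \<Rightarrow> real" and K
  proof -
    show "integrable M (\<lambda>w. f (X w))"
      by (rule integrable_const_bound[where B=K]) (auto intro!: AE_I2 fM XE)
    have "\<bar>f (X w) * U w\<bar> \<le> K * C" if "w \<in> space M" for w
      using fM[OF XE[OF that]] C(2)[OF that] unfolding abs_mult
      by (intro mult_mono) auto
    then show "integrable M (\<lambda>w. f (X w) * U w)"
      by (intro integrable_const_bound[where B="K * C"]) (auto intro!: AE_I2)
  qed
  \<comment> \<open>Passing from \<open>M\<close> to the density measure \<open>Q\<close> changes
    the expectation of \<open>f (X w)\<close> exactly by the weighted integral of interest, divided
    by \<open>C\<close>.\<close>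
  have Qint: "(\<integral>s. f s \<partial>distr Q (site_space E) X)
      = (\<integral>s. f s \<partial>distr M (site_space E) X) + (\<integral>w. f (X w) * U w \<partial>M) / C"
    if f[measurable]: "f \<in> borel_measurable (site_space E)" and fM: "\<And>s. s \<in> E \<Longrightarrow> \<bar>f s\<bar> \<le> K"
    for f :: "real \<Rightarrow> real" and K
  proof -
    have "(\<integral>s. f s \<partial>distr Q (site_space E) X) = (\<integral>w. f (X w) \<partial>Q)"
      by (rule integral_distr) (auto simp: Q_def)
    also have "\<dots> = (\<integral>w. g w *\<^sub>R f (X w) \<partial>M)"
      unfolding Q_def by (rule integral_density) (auto intro!: AE_I2 g0)
    also have "\<dots> = (\<integral>w. f (X w) + f (X w) * U w / C \<partial>M)"
      by (intro Bochner_Integration.integral_cong) (auto simp: g_def algebra_simps)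
    also have "\<dots> = (\<integral>w. f (X w) \<partial>M) + (\<integral>w. f (X w) * U w \<partial>M) / C"
      using intU[OF f fM] by simp
    also have "(\<integral>w. f (X w) \<partial>M) = (\<integral>s. f s \<partial>distr M (site_space E) X)"
      by (rule integral_distr[symmetric]) auto
    finally show ?thesis .
  qed
  \<comment> \<open>The case \<open>k = 0\<close> of the hypothesis, where \<open>d 0\<close> is 1,
    says that \<open>U\<close> has mean 0; hence \<open>Q\<close> has total mass 1.\<close>
  have "(\<integral>w. U w \<partial>M) = (\<integral>w. d 0 (X w) * U w \<partial>M)"
    by (intro Bochner_Integration.integral_cong) (auto simp: d_0 XE)
  then have U0: "(\<integral>w. U w \<partial>M) = 0" using zero[OF zero_mem] by simp
  have "prob_space Q"
  proof (rule prob_spaceI)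
    have "emeasure Q (space Q) = (\<integral>\<^sup>+w. ennreal (g w) \<partial>M)"
      unfolding Q_def by (simp add: emeasure_density cong: nn_integral_cong)
    also have "\<dots> = ennreal (\<integral>w. g w \<partial>M)"
    proof (rule nn_integral_eq_integral)
      show "integrable M g"
        using intU(1)[of "\<lambda>_. 1" 1] unfolding g_def by simp
    qed (auto intro!: AE_I2 g0)
    also have "(\<integral>w. g w \<partial>M) = 1"
      using intU(1)[of "\<lambda>_. 1" 1] U0 unfolding g_def by (simp add: prob_space)
    finally show "emeasure Q (space Q) = 1" by simp
  qed
  then have p1: "prob_space (distr Q (site_space E) X)"
    by (rule prob_space.prob_space_distr) (simp add: Q_def)
  have p2: "prob_space (distr M (site_space E) X)" by (rule prob_space_distr) simp
  have "distr Q (site_space E) X = distr M (site_space E) X"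
  proof (rule det[unfolded measure_determining_def, rule_format], intro conjI ballI)
    fix k assume k: "k \<in> Ehat"
    obtain K where K: "\<And>s. s \<in> E \<Longrightarrow> \<bar>d k s\<bar> \<le> K" using d_bounded[OF k] by blast
    show "(\<integral>s. d k s \<partial>distr Q (site_space E) X) = (\<integral>s. d k s \<partial>distr M (site_space E) X)"
      using Qint[OF d_measurable[OF k] K] zero[OF k] by simp
  qed (auto intro: integrable_d p1 p2)
  \<comment> \<open>Since the two laws of \<open>X\<close> coincide, the correction term in
    \<open>Qint\<close> must vanish for \<open>f = indicator A\<close>.\<close>
  with Qint[of "indicator A" 1] C(1) show ?thesis by (auto simp: indicator_def)
qed

text \<open>Induction on the set \<open>G\<close> of sites that carry indicators. A site
  \<open>z\<close> is first treated with factors \<open>d j\<close> in place of its indicator, which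
  is the induction hypothesis with \<open>z\<close> moved into \<open>F\<close>; this is why
  \<open>F\<close> and \<open>k\<close> are arbitrary. As \<open>j\<close> runs through
  \<open>Ehat\<close>, measure determination replaces \<open>d j\<close> by the indicator of
  \<open>A z\<close>.\<close>

lemma integral_cylinder_eq:
  assumes det: "measure_determining Ehat E d"
    and M: "prob_space M" "sets M = sets (config_space E)"
    and \<nu>: "prob_space \<nu>" "sets \<nu> = sets (site_space E)"
    and \<nu>_moments: "\<And>k. k \<in> Ehat \<Longrightarrow> (\<integral>s. d k s \<partial>\<nu>) = c ^ k"
    and M_moments: "\<And>\<xi>. \<xi> \<in> finite_configs Ehat \<Longrightarrow> (\<integral>\<eta>. factorized d \<xi> \<eta> \<partial>M) = c ^ particles \<xi>"
    and fin: "finite G" "finite F" and disj: "G \<inter> F = {}"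
    and A: "\<And>x. x \<in> G \<Longrightarrow> A x \<in> sets (site_space E)" and k: "\<And>y. y \<in> F \<Longrightarrow> k y \<in> Ehat"
  shows "(\<integral>\<eta>. (\<Prod>x\<in>G. indicator (A x) (\<eta> x)) * (\<Prod>y\<in>F. d (k y) (\<eta> y)) \<partial>M)
    = (\<Prod>x\<in>G. measure \<nu> (A x)) * (\<Prod>y\<in>F. c ^ k y)"
  using fin(1,2) disj A k
proof (induction G arbitrary: F k rule: finite_induct)
  case empty
  \<comment> \<open>Without indicators the integrand is the duality function of the configuration
    \<open>k\<close>, set to 0 outside \<open>F\<close>, so the moment hypothesis applies.\<close>
  define \<xi> where "\<xi> = (\<lambda>y. if y \<in> F then k y else 0)"
  have \<xi>: "\<xi> \<in> finite_configs Ehat"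
    using empty zero_mem by (auto simp: \<xi>_def finite_configs_iff)
  have "particles \<xi> = sum \<xi> F"
    using empty by (intro particles_eq_sum_superset) (auto simp: \<xi>_def)
  then have "particles \<xi> = sum k F" by (simp add: \<xi>_def)
  moreover have "(\<integral>\<eta>. factorized d \<xi> \<eta> \<partial>M) = (\<integral>\<eta>. (\<Prod>y\<in>F. d (k y) (\<eta> y)) \<partial>M)"
  proof (rule Bochner_Integration.integral_cong[OF refl])
    fix \<eta> assume "\<eta> \<in> space M"
    then have "factorized d \<xi> \<eta> = (\<Prod>y\<in>F. d (\<xi> y) (\<eta> y))"
      using empty sets_eq_imp_space_eq[OF M(2)] by (intro factorized_eq) (auto simp: \<xi>_def)
    then show "factorized d \<xi> \<eta> = (\<Prod>y\<in>F. d (k y) (\<eta> y))" by (simp add: \<xi>_def)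
  qed
  ultimately show ?case using M_moments[OF \<xi>] by (simp add: power_sum)
next
  case (insert z G)
  interpret prob_space M by fact
  have spM: "space M = space (config_space E)" using M(2) by (rule sets_eq_imp_space_eq)
  have coord[measurable]: "(\<lambda>\<eta>. \<eta> x) \<in> measurable M (site_space E)" for x
    using measurable_coordinate[of x E] by (simp add: measurable_cong_sets[OF M(2) refl])
  have Az[measurable]: "A z \<in> sets (site_space E)" using insert.prems by simp
  \<comment> \<open>\<open>Z\<close> is the integrand with the site \<open>z\<close> left out, and
    \<open>p\<close> is the value that the claim predicts for its integral.\<close>
  define Z where "Z \<eta> = (\<Prod>x\<in>G. indicator (A x) (\<eta> x)) * (\<Prod>y\<in>F. d (k y) (\<eta> y))" for \<eta>
  define p where "p = (\<Prod>x\<in>G. measure \<nu> (A x)) * (\<Prod>y\<in>F. c ^ k y)"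
  have prems: "finite F" "G \<inter> F = {}" "z \<notin> F" "z \<notin> G"
      "\<And>x. x \<in> G \<Longrightarrow> A x \<in> sets (site_space E)" "\<And>y. y \<in> F \<Longrightarrow> k y \<in> Ehat"
    using insert.prems insert.hyps by auto
  have Z_meas[measurable]: "Z \<in> borel_measurable M"
    unfolding Z_def
    by (intro borel_measurable_times borel_measurable_prod)
      (use prems in \<open>auto intro: measurable_compose[OF coord d_measurable]
        measurable_compose[OF coord borel_measurable_indicator]\<close>)
  obtain K where K: "\<And>j s. j \<in> Ehat \<Longrightarrow> s \<in> E \<Longrightarrow> \<bar>d j s\<bar> \<le> K j" using d_bounded by metis
  have ZB: "\<bar>Z \<eta>\<bar> \<le> (\<Prod>y\<in>F. K (k y))" if "\<eta> \<in> space M" for \<eta>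
  proof -
    have 1: "\<bar>\<Prod>x\<in>G. indicator (A x) (\<eta> x) :: real\<bar> \<le> 1"
      by (auto simp: abs_prod intro!: prod_le_1)
    have 2: "\<bar>\<Prod>y\<in>F. d (k y) (\<eta> y)\<bar> \<le> (\<Prod>y\<in>F. K (k y))"
      using prems that by (auto simp: abs_prod spM mem_space_config intro!: prod_mono K)
    show ?thesis
      unfolding Z_def abs_mult using mult_mono[OF 1 2] by simp
  qed
  have Z_int: "integrable M Z"
    by (rule integrable_const_bound[where B="\<Prod>y\<in>F. K (k y)"]) (auto intro!: AE_I2 ZB)
  have marg: "integrable M (\<lambda>\<eta>. d j (\<eta> z))" "(\<integral>\<eta>. d j (\<eta> z) \<partial>M) = c ^ j" if "j \<in> Ehat" for j
  proof -
    have eq: "factorized d (pile j z) \<eta> = d j (\<eta> z)" if "\<eta> \<in> space M" for \<eta>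
      using that by (simp add: factorized_pile spM)
    show "integrable M (\<lambda>\<eta>. d j (\<eta> z))"
      using integrable_factorized[OF M pile_mem[OF that], of z] eq
      by (simp cong: Bochner_Integration.integrable_cong)
    show "(\<integral>\<eta>. d j (\<eta> z) \<partial>M) = c ^ j"
      using M_moments[OF pile_mem[OF that], of z] eq
      by (simp cong: Bochner_Integration.integral_cong)
  qed
  have Z_moment: "integrable M (\<lambda>\<eta>. d j (\<eta> z) * Z \<eta>)" "(\<integral>\<eta>. d j (\<eta> z) * Z \<eta> \<partial>M) = c ^ j * p"
    if j: "j \<in> Ehat" for j
  proof -
    show "integrable M (\<lambda>\<eta>. d j (\<eta> z) * Z \<eta>)"
    proof (rule integrable_const_bound[where B="K j * (\<Prod>y\<in>F. K (k y))"])
      have "\<bar>d j (\<eta> z) * Z \<eta>\<bar> \<le> K j * (\<Prod>y\<in>F. K (k y))" if "\<eta> \<in> space M" for \<eta>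
      proof -
        have "\<bar>d j (\<eta> z)\<bar> \<le> K j" using that j by (auto simp: spM mem_space_config intro: K)
        then show ?thesis unfolding abs_mult using ZB[OF that] by (intro mult_mono) auto
      qed
      then show "AE \<eta> in M. norm (d j (\<eta> z) * Z \<eta>) \<le> K j * (\<Prod>y\<in>F. K (k y))" by simp
    qed (intro borel_measurable_times Z_meas measurable_compose[OF coord d_measurable[OF j]])
    \<comment> \<open>The induction hypothesis for the enlarged set \<open>insert z F\<close>, with
      \<open>j\<close> particles assigned to \<open>z\<close>.\<close>
    have "(\<integral>\<eta>. (\<Prod>x\<in>G. indicator (A x) (\<eta> x)) * (\<Prod>y\<in>insert z F. d ((k(z := j)) y) (\<eta> y)) \<partial>M)
      = (\<Prod>x\<in>G. measure \<nu> (A x)) * (\<Prod>y\<in>insert z F. c ^ (k(z := j)) y)"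
      by (rule insert.IH) (use prems j in auto)
    also have "(\<Prod>y\<in>insert z F. c ^ (k(z := j)) y) = c ^ j * (\<Prod>y\<in>F. c ^ k y)"
    proof -
      have "(\<Prod>y\<in>F. c ^ (k(z := j)) y) = (\<Prod>y\<in>F. c ^ k y)"
        by (rule prod.cong) (use prems in auto)
      then show ?thesis unfolding prod.insert[OF prems(1,3)] fun_upd_same by (rule arg_cong)
    qed
    also have "(\<lambda>\<eta>. \<Prod>y\<in>insert z F. d ((k(z := j)) y) (\<eta> y))
        = (\<lambda>\<eta>. d j (\<eta> z) * (\<Prod>y\<in>F. d (k y) (\<eta> y)))"
    proof
      fix \<eta> :: "'a \<Rightarrow> real"
      have "(\<Prod>y\<in>F. d ((k(z := j)) y) (\<eta> y)) = (\<Prod>y\<in>F. d (k y) (\<eta> y))"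
        by (rule prod.cong) (use prems in auto)
      then show "(\<Prod>y\<in>insert z F. d ((k(z := j)) y) (\<eta> y)) = d j (\<eta> z) * (\<Prod>y\<in>F. d (k y) (\<eta> y))"
        unfolding prod.insert[OF prems(1,3)] fun_upd_same by (rule arg_cong)
    qed
    finally show "(\<integral>\<eta>. d j (\<eta> z) * Z \<eta> \<partial>M) = c ^ j * p"
      by (simp add: Z_def p_def mult_ac)
  qed
  \<comment> \<open>The bounded weight \<open>Z - p\<close> is orthogonal to every
    \<open>d j (\<eta> z)\<close>, because both terms contribute \<open>c ^ j * p\<close>.
    Orthogonality to the indicator of \<open>A z\<close> follows.\<close>
  have zero: "(\<integral>\<eta>. indicator (A z) (\<eta> z) * (Z \<eta> - p) \<partial>M) = 0"
  proof (rule weighted_measure_determining[OF det M(1) coord _ _ _ Az])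
    show "\<bar>Z \<eta> - p\<bar> \<le> (\<Prod>y\<in>F. K (k y)) + \<bar>p\<bar>" if "\<eta> \<in> space M" for \<eta>
      using ZB[OF that] by linarith
    show "(\<integral>\<eta>. d j (\<eta> z) * (Z \<eta> - p) \<partial>M) = 0" if "j \<in> Ehat" for j
      using Z_moment[OF that] marg[OF that] by (simp add: right_diff_distrib)
  qed simp
  \<comment> \<open>The marginal at \<open>z\<close> and \<open>\<nu>\<close> both have the moments
    \<open>c ^ j\<close>. Hence \<open>A z\<close> has probability
    \<open>measure \<nu> (A z)\<close>, which evaluates the term with \<open>p\<close>.\<close>
  have "distr M (site_space E) (\<lambda>\<eta>. \<eta> z) = \<nu>"
  proof (rule det[unfolded measure_determining_def, rule_format], intro conjI ballI)
    show p: "prob_space (distr M (site_space E) (\<lambda>\<eta>. \<eta> z))" by (rule prob_space_distr) simp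
    fix j assume j: "j \<in> Ehat"
    show "integrable (distr M (site_space E) (\<lambda>\<eta>. \<eta> z)) (d j)" "integrable \<nu> (d j)"
      using j \<nu> by (auto intro: integrable_d p)
    show "(\<integral>s. d j s \<partial>distr M (site_space E) (\<lambda>\<eta>. \<eta> z)) = (\<integral>s. d j s \<partial>\<nu>)"
      using marg(2)[OF j] \<nu>_moments[OF j] d_measurable[OF j] by (subst integral_distr) auto
  qed (use \<nu> in auto)
  then have "measure \<nu> (A z) = (\<integral>s. indicator (A z) s \<partial>distr M (site_space E) (\<lambda>\<eta>. \<eta> z))"
    using sets.Int_space_eq2[OF Az] by (simp add: \<nu>(2)[THEN sets_eq_imp_space_eq])
  also have "\<dots> = (\<integral>\<eta>. indicator (A z) (\<eta> z) \<partial>M)"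
    by (rule integral_distr) auto
  finally have ind: "(\<integral>\<eta>. indicator (A z) (\<eta> z) \<partial>M) = measure \<nu> (A z)" by simp
  have int1: "integrable M (\<lambda>\<eta>. indicator (A z) (\<eta> z) :: real)"
    by (rule integrable_const_bound[where B=1]) (auto simp: indicator_def)
  have int2: "integrable M (\<lambda>\<eta>. indicator (A z) (\<eta> z) * Z \<eta>)"
    by (rule Bochner_Integration.integrable_bound[OF Z_int]) (auto simp: indicator_def)
  have "(\<integral>\<eta>. indicator (A z) (\<eta> z) * Z \<eta> \<partial>M) = measure \<nu> (A z) * p"
    using zero int1 int2 ind by (simp add: right_diff_distrib)
  then show ?case
    using prems insert.hyps by (simp add: Z_def p_def mult_ac)
qed

text \<open>Finite-dimensional cylinders determine a measure on the product space, and their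
  probabilities are the case of \<open>integral_cylinder_eq\<close> in which every site under
  consideration carries an indicator.\<close>

lemma eq_PiM_of_moments:
  assumes det: "measure_determining Ehat E d"
    and M: "prob_space M" "sets M = sets (config_space E)"
    and \<nu>: "prob_space \<nu>" "sets \<nu> = sets (site_space E)"
    and \<nu>_moments: "\<And>k. k \<in> Ehat \<Longrightarrow> (\<integral>s. d k s \<partial>\<nu>) = c ^ k"
    and M_moments: "\<And>\<xi>. \<xi> \<in> finite_configs Ehat \<Longrightarrow> (\<integral>\<eta>. factorized d \<xi> \<eta> \<partial>M) = c ^ particles \<xi>"
  shows "M = (\<Pi>\<^sub>M x\<in>UNIV. \<nu>)"
proof -
  interpret M: prob_space M by fact
  interpret \<nu>: prob_space \<nu> by fact
  interpret product_prob_space "\<lambda>_. \<nu>" UNIV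
    by (intro product_prob_spaceI \<nu>)
  have sets_eq: "sets M = sets (\<Pi>\<^sub>M x\<in>UNIV. \<nu>)"
    unfolding M(2) config_space_def by (intro sets_PiM_cong) (auto simp: \<nu>)
  show ?thesis
  proof (rule PiM_eq[OF sets_eq])
    fix J :: "'a set" and B :: "'a \<Rightarrow> real set"
    assume J: "finite J" and B: "\<And>j. j \<in> J \<Longrightarrow> B j \<in> sets \<nu>"
    let ?C = "prod_emb UNIV (\<lambda>_. \<nu>) J (\<Pi>\<^sub>E j\<in>J. B j)"
    have C: "?C \<in> sets M"
      unfolding sets_eq by (intro sets_PiM_I) (use J B in auto)
    have "measure M ?C = (\<integral>\<eta>. indicator ?C \<eta> \<partial>M)"
      using sets.Int_space_eq2[OF C] by simp
    also have "\<dots> = (\<integral>\<eta>. (\<Prod>x\<in>J. indicator (B x) (\<eta> x)) * (\<Prod>y\<in>{}. d 0 (\<eta> y)) \<partial>M)"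
    proof (rule Bochner_Integration.integral_cong[OF refl])
      fix \<eta> assume "\<eta> \<in> space M"
      then have "\<eta> \<in> space (\<Pi>\<^sub>M x\<in>UNIV. \<nu>)" using sets_eq_imp_space_eq[OF sets_eq] by simp
      then have "\<eta> \<in> ?C \<longleftrightarrow> (\<forall>x\<in>J. \<eta> x \<in> B x)"
        by (auto simp: prod_emb_def space_PiM restrict_def PiE_iff extensional_def)
      then show "indicator ?C \<eta> = (\<Prod>x\<in>J. indicator (B x) (\<eta> x)) * (\<Prod>y\<in>{}. d 0 (\<eta> y))"
        using J by (auto simp: indicator_def prod_zero_iff)
    qed
    also have "\<dots> = (\<Prod>x\<in>J. measure \<nu> (B x))"
      using integral_cylinder_eq[OF det M \<nu> \<nu>_moments M_moments J finite.emptyI, of B "\<lambda>_. 0"] B \<nu>(2)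
      by simp
    finally show "emeasure M ?C = (\<Prod>j\<in>J. emeasure \<nu> (B j))"
      by (simp add: M.emeasure_eq_measure \<nu>.emeasure_eq_measure prod_ennreal)
  qed
qed

end

section \<open>From uniform domination to bounded factors\<close>

text \<open>Both properties of \<open>d k\<close> are read off from piles of \<open>k\<close>
  particles: measurability along constant configurations, boundedness from a single configuration at
  which a finite dominating value must bound \<open>d k\<close> at all sites simultaneously.\<close>

lemma bounded_factor_of_domination:
  fixes d :: "nat \<Rightarrow> real \<Rightarrow> real" and \<mu> :: "('a \<Rightarrow> real) measure"
  assumes inf: "infinite (UNIV :: 'a set)" and mem: "0 \<in> Ehat" "1 \<in> Ehat"
    and d0: "\<And>s. s \<in> E \<Longrightarrow> d 0 s = 1"
    and meas: "\<And>\<xi> :: 'a \<Rightarrow> nat. \<xi> \<in> finite_configs Ehat \<Longrightarrow>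
      factorized d \<xi> \<in> borel_measurable (config_space E)"
    and sets: "sets \<mu> = sets (config_space E)"
    and dom: "uniform_domination (finite_configs Ehat) \<mu> (factorized d)"
  shows "bounded_factor E Ehat d"
proof
  fix k assume k: "k \<in> Ehat"
  have pile_mem: "pile k x \<in> finite_configs Ehat" for x :: 'a
    using k mem by (auto simp: finite_configs_iff pile_def)
  have fact_pile: "factorized d (pile k x) \<eta> = d k (\<eta> x)"
    if "\<eta> \<in> space (config_space E)" for x :: 'a and \<eta>
    using that by (subst factorized_eq_prod[where F="{x}" and E=E]) (auto simp: pile_def d0)
  have const: "(\<lambda>s x. s) \<in> measurable (site_space E) (config_space E :: ('a \<Rightarrow> real) measure)"
    unfolding config_space_def by (rule measurable_abs_UNIV) simp
  have eq: "factorized d (pile k (undefined :: 'a)) (\<lambda>x. s) = d k s" if "s \<in> space (site_space E)" for s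
    using that by (subst fact_pile) (auto simp: mem_space_config)
  have "(\<lambda>s. factorized d (pile k (undefined :: 'a)) (\<lambda>x. s)) \<in> borel_measurable (site_space E)"
    by (rule measurable_compose[OF const meas[OF pile_mem]])
  then show "d k \<in> borel_measurable (site_space E)"
    by (subst (asm) measurable_cong[OF eq])
  text \<open>The domination holds at every configuration, in particular at one whose entries make
    \<open>d k\<close> larger and larger along infinitely many sites.\<close>
  show "\<exists>M. \<forall>s\<in>E. \<bar>d k s\<bar> \<le> M"
  proof (rule ccontr)
    assume "\<nexists>M. \<forall>s\<in>E. \<bar>d k s\<bar> \<le> M"
    then have "\<forall>i::nat. \<exists>s\<in>E. real i < \<bar>d k s\<bar>" by (meson not_le)
    then obtain s where s: "\<And>i. s i \<in> E" "\<And>i::nat. real i < \<bar>d k (s i)\<bar>" by metis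
    obtain g :: "nat \<Rightarrow> 'a" where g: "inj g" using infinite_countable_subset[OF inf] by auto
    \<comment> \<open>The site \<open>g i\<close> receives the value \<open>s i\<close>. Sites
      outside the range of \<open>g\<close> also receive some value of \<open>s\<close>, so every
      entry lies in \<open>E\<close>.\<close>
    define \<eta> where "\<eta> x = s (inv g x)" for x
    have \<eta>: "\<eta> \<in> space (config_space E)" by (simp add: \<eta>_def mem_space_config s)
    have \<eta>': "\<eta> \<in> space \<mu>" using \<eta> sets_eq_imp_space_eq[OF sets] by simp
    obtain f :: "('a \<Rightarrow> real) \<Rightarrow> real"
      where f: "(SUP \<xi>\<in>{\<xi> \<in> finite_configs Ehat. particles \<xi> = k}. ereal \<bar>factorized d \<xi> \<eta>\<bar>) \<le> ereal (f \<eta>)"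
      using spec[OF dom[unfolded uniform_domination_def], of k] bspec[OF _ \<eta>'] by blast
    have "real i \<le> f \<eta>" for i
    proof -
      have "ereal \<bar>factorized d (pile k (g i)) \<eta>\<bar> \<le> ereal (f \<eta>)"
        by (rule order_trans[OF SUP_upper f]) (simp add: pile_mem)
      then show ?thesis
        using s(2)[of i] g by (simp add: fact_pile[OF \<eta>] \<eta>_def)
    qed
    then show False using reals_Archimedean2[of "f \<eta>"] by (meson not_le)
  qed
qed (use mem d0 in auto)

section \<open>Duality and the law at time \<open>t\<close>\<close>

locale factorized_duality =
  bounded_factor E Ehat d +
  X: markov_process "config_space E :: ('a::countable \<Rightarrow> real) measure" W P X +
  X': markov_process "count_space (finite_configs Ehat :: ('a \<Rightarrow> nat) set)" W' P' X'
  for E Ehat d W P X W' P' X' +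
  assumes dual: "dual_processes (count_space (finite_configs Ehat)) P' X' (config_space E) P X (factorized d)"
    and conserves: "conserves_particles (finite_configs Ehat) P' X'"
begin

lemma prob_P': "\<xi> \<in> finite_configs Ehat \<Longrightarrow> prob_space (P' \<xi>)"
  and sets_P': "\<xi> \<in> finite_configs Ehat \<Longrightarrow> sets (P' \<xi>) = sets W'"
  using measurable_space[OF X'.kernel, of \<xi>] by (auto simp: space_prob_algebra)

lemma measurable_dual_coordinate:
  assumes "\<xi> \<in> finite_configs Ehat" "0 \<le> t"
  shows "X' t \<in> measurable (P' \<xi>) (count_space (finite_configs Ehat))"
  using X'.coordinate[OF assms(2)] by (simp add: measurable_cong_sets[OF sets_P'[OF assms(1)] refl])

lemma law_prob:
  assumes "prob_space \<mu>" "sets \<mu> = sets (config_space E)"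
  shows "P \<in> measurable \<mu> (prob_algebra W)" "prob_space (\<mu> \<bind> P)" "sets (\<mu> \<bind> P) = sets W"
proof -
  show P: "P \<in> measurable \<mu> (prob_algebra W)"
    using X.kernel by (simp add: measurable_cong_sets[OF assms(2) refl])
  have "\<mu> \<in> space (prob_algebra \<mu>)" by (simp add: space_prob_algebra assms)
  then show "prob_space (\<mu> \<bind> P)" "sets (\<mu> \<bind> P) = sets W"
    using prob_space_bind'[OF _ P] sets_bind'[OF _ P] by simp_all
qed

text \<open>Stationarity includes time 0, while duality speaks only of positive times; at time 0 the
  initial condition of the Markov process takes its place.\<close>

lemma distr_law_0:
  assumes \<mu>: "prob_space \<mu>" "sets \<mu> = sets (config_space E)"
  shows "distr (\<mu> \<bind> P) (config_space E) (X 0) = \<mu>"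
proof -
  interpret prob_space \<mu> by fact
  have "distr (\<mu> \<bind> P) (config_space E) (X 0) = \<mu> \<bind> (\<lambda>\<eta>. distr (P \<eta>) (config_space E) (X 0))"
    by (rule distr_bind[OF measurable_prob_algebraD[OF law_prob(1)[OF \<mu>]] not_empty X.coordinate]) simp
  also have "\<dots> = \<mu> \<bind> return (config_space E)"
    using sets_eq_imp_space_eq[OF \<mu>(2)] by (intro bind_cong refl X.start) simp
  also have "\<dots> = \<mu>" by (rule bind_return''[OF \<mu>(2)])
  finally show ?thesis .
qed

text \<open>Disintegrate over the initial configuration, apply duality at each fixed
  \<open>\<eta>\<close>, then exchange the two integrals. Conservation supplies the bound for
  Fubini, since \<open>factorized_bounded\<close> is uniform only at a fixed particle
  number.\<close>

lemma integral_law: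
  assumes \<mu>: "prob_space \<mu>" "sets \<mu> = sets (config_space E)" and t: "0 < t"
    and \<xi>: "\<xi> \<in> finite_configs Ehat"
  shows "(\<integral>\<eta>. factorized d \<xi> \<eta> \<partial>distr (\<mu> \<bind> P) (config_space E) (X t))
    = (\<integral>w. (\<integral>\<eta>. factorized d (X' t w) \<eta> \<partial>\<mu>) \<partial>P' \<xi>)"
proof -
  interpret \<mu>: prob_space \<mu> by fact
  interpret Q: prob_space "P' \<xi>" by (rule prob_P'[OF \<xi>])
  interpret pair: pair_prob_space "P' \<xi>" \<mu> ..
  define n where "n = particles \<xi>"
  obtain B where B: "\<And>(\<zeta> :: 'a \<Rightarrow> nat) \<eta>. \<zeta> \<in> finite_configs Ehat \<Longrightarrow> particles \<zeta> = n \<Longrightarrow>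
      \<eta> \<in> space (config_space E) \<Longrightarrow> \<bar>factorized d \<zeta> \<eta>\<bar> \<le> B"
    using factorized_bounded[of n] by metis
  have sp\<mu>: "space \<mu> = space (config_space E)" by (rule sets_eq_imp_space_eq[OF \<mu>(2)])
  \<comment> \<open>The cutoff makes the integrand bounded everywhere rather than almost surely; by
    conservation it changes neither iterated integral.\<close>
  define D where "D \<zeta> \<eta> = (if particles \<zeta> = n then factorized d \<zeta> \<eta> else 0)"
    for \<zeta> :: "'a \<Rightarrow> nat" and \<eta>
  have X't: "X' t \<in> measurable (P' \<xi>) (count_space (finite_configs Ehat))"
    using t by (intro measurable_dual_coordinate[OF \<xi>]) simp
  have discrete: "(\<lambda>w. h (X' t w)) \<in> borel_measurable (P' \<xi>)" for h :: "('a \<Rightarrow> nat) \<Rightarrow> real"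
    by (rule measurable_compose[OF X't]) simp
  have conserved: "AE w in P' \<xi>. particles (X' t w) = n"
    using conserves t \<xi> unfolding conserves_particles_def n_def by simp
  have DB: "\<bar>D \<zeta> \<eta>\<bar> \<le> \<bar>B\<bar>" if "\<zeta> \<in> finite_configs Ehat" "\<eta> \<in> space \<mu>" for \<zeta> \<eta>
    using B[OF that(1), of \<eta>] that(2) by (auto simp: D_def sp\<mu>)
  have D_meas: "D \<zeta> \<in> borel_measurable \<mu>" if "\<zeta> \<in> finite_configs Ehat" for \<zeta>
    using factorized_measurable[OF that] unfolding D_def
    by (simp add: measurable_cong_sets[OF \<mu>(2) refl])
  \<comment> \<open>The dual state space is countable and discrete, so measurability in
    \<open>\<eta>\<close> for each fixed dual configuration suffices.\<close>
  have joint: "(\<lambda>p. D (X' t (fst p)) (snd p)) \<in> borel_measurable (P' \<xi> \<Otimes>\<^sub>M \<mu>)"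
    by (rule measurable_compose_countable'[where I="finite_configs Ehat"])
      (auto intro: measurable_compose[OF measurable_snd D_meas] measurable_compose[OF measurable_fst X't]
        countable_finite_configs)
  have Xt: "X t \<in> measurable W (config_space E)" using t by (intro X.coordinate) simp
  obtain B' where B': "\<And>\<eta>. \<eta> \<in> space (config_space E) \<Longrightarrow> \<bar>factorized d \<xi> \<eta>\<bar> \<le> B'"
    using B[OF \<xi>] n_def by blast
  have "(\<integral>\<eta>. factorized d \<xi> \<eta> \<partial>distr (\<mu> \<bind> P) (config_space E) (X t))
      = (\<integral>w. factorized d \<xi> (X t w) \<partial>(\<mu> \<bind> P))"
    by (rule integral_distr)
      (use Xt factorized_measurable[OF \<xi>] in \<open>auto simp: measurable_cong_sets[OF law_prob(3)[OF \<mu>] refl]\<close>)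
  also have "\<dots> = (\<integral>\<eta>. (\<integral>w. factorized d \<xi> (X t w) \<partial>P \<eta>) \<partial>\<mu>)"
    by (rule integral_bind_bounded[OF \<mu>(1) law_prob(1)[OF \<mu>], where B=B'])
      (use measurable_compose[OF Xt factorized_measurable[OF \<xi>]] B' measurable_space[OF Xt] in auto)
  also have "\<dots> = (\<integral>\<eta>. (\<integral>w. factorized d (X' t w) \<eta> \<partial>P' \<xi>) \<partial>\<mu>)"
    using dual t \<xi> by (intro Bochner_Integration.integral_cong) (auto simp: dual_processes_def sp\<mu>)
  also have "\<dots> = (\<integral>\<eta>. (\<integral>w. D (X' t w) \<eta> \<partial>P' \<xi>) \<partial>\<mu>)"
    using conserved
    by (intro Bochner_Integration.integral_cong refl integral_cong_AE discrete) (auto simp: D_def)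
  also have "\<dots> = (\<integral>w. (\<integral>\<eta>. D (X' t w) \<eta> \<partial>\<mu>) \<partial>P' \<xi>)"
  proof (rule pair.Fubini_integral)
    show "integrable (P' \<xi> \<Otimes>\<^sub>M \<mu>) (\<lambda>(w, \<eta>). D (X' t w) \<eta>)"
      by (rule pair.integrable_const_bound[where B="\<bar>B\<bar>"])
        (use joint DB measurable_space[OF X't] in \<open>auto simp: space_pair_measure split_beta\<close>)
  qed
  also have "\<dots> = (\<integral>w. (\<integral>\<eta>. factorized d (X' t w) \<eta> \<partial>\<mu>) \<partial>P' \<xi>)"
    using conserved by (intro integral_cong_AE discrete) (auto simp: D_def)
  finally show ?thesis .
qed

section \<open>Stationary product measures and moments\<close>

text \<open>The bounds on \<open>D\<close> may grow with the particle number, so the integrals of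
  \<open>D \<xi>\<close> need not form a bounded function of \<open>\<xi>\<close>. Cut off to
  \<open>n\<close> particles the function is bounded, and conservation keeps it harmonic; triviality
  then makes it constant on that level.\<close>

lemma stationary_integral_eq:
  assumes triv: "bounded_harmonic_triviality (finite_configs Ehat) P' X'"
    and \<mu>: "prob_space \<mu>" "sets \<mu> = sets (config_space E)"
    and stat: "stationary (config_space E) P X \<mu>"
    and \<xi>: "\<xi> \<in> finite_configs Ehat" and \<zeta>: "\<zeta> \<in> finite_configs Ehat"
    and eq: "particles \<xi> = particles \<zeta>"
  shows "(\<integral>\<eta>. factorized d \<xi> \<eta> \<partial>\<mu>) = (\<integral>\<eta>. factorized d \<zeta> \<eta> \<partial>\<mu>)"
proof -
  interpret prob_space \<mu> by fact
  define n where "n = particles \<xi>"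
  define H where "H \<xi> = (if particles \<xi> = n then \<integral>\<eta>. factorized d \<xi> \<eta> \<partial>\<mu> else 0)" for \<xi> :: "'a \<Rightarrow> nat"
  obtain B where B: "\<And>(\<zeta> :: 'a \<Rightarrow> nat) \<eta>. \<zeta> \<in> finite_configs Ehat \<Longrightarrow> particles \<zeta> = n \<Longrightarrow>
      \<eta> \<in> space (config_space E) \<Longrightarrow> \<bar>factorized d \<zeta> \<eta>\<bar> \<le> B"
    using factorized_bounded[of n] by metis
  have "\<bar>H \<zeta>\<bar> \<le> \<bar>B\<bar>" if \<zeta>: "\<zeta> \<in> finite_configs Ehat" for \<zeta>
  proof (cases "particles \<zeta> = n")
    case True
    have "\<bar>\<integral>\<eta>. factorized d \<zeta> \<eta> \<partial>\<mu>\<bar> \<le> (\<integral>\<eta>. \<bar>factorized d \<zeta> \<eta>\<bar> \<partial>\<mu>)" by (rule integral_abs_bound)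
    also have "\<dots> \<le> (\<integral>\<eta>. B \<partial>\<mu>)"
      using integrable_factorized[OF \<mu> \<zeta>] B[OF \<zeta> True] sets_eq_imp_space_eq[OF \<mu>(2)]
      by (intro integral_mono) auto
    finally show ?thesis using True by (simp add: H_def prob_space)
  qed (simp add: H_def)
  then have "bounded (H ` finite_configs Ehat)" by (auto simp: bounded_iff)
  moreover have "(\<integral>w. H (X' t w) \<partial>P' \<zeta>) = H \<zeta>" if t: "0 < t" and \<zeta>: "\<zeta> \<in> finite_configs Ehat" for t \<zeta>
  proof -
    have X't: "X' t \<in> measurable (P' \<zeta>) (count_space (finite_configs Ehat))"
      using t by (intro measurable_dual_coordinate[OF \<zeta>]) simp
    have discrete: "(\<lambda>w. h (X' t w)) \<in> borel_measurable (P' \<zeta>)" for h :: "('a \<Rightarrow> nat) \<Rightarrow> real"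
      by (rule measurable_compose[OF X't]) simp
    have conserved: "AE w in P' \<zeta>. particles (X' t w) = particles \<zeta>"
      using conserves t \<zeta> unfolding conserves_particles_def by simp
    show ?thesis
    proof (cases "particles \<zeta> = n")
      case True
      have "(\<integral>w. H (X' t w) \<partial>P' \<zeta>) = (\<integral>w. (\<integral>\<eta>. factorized d (X' t w) \<eta> \<partial>\<mu>) \<partial>P' \<zeta>)"
        using conserved True by (intro integral_cong_AE discrete) (auto simp: H_def)
      also have "\<dots> = (\<integral>\<eta>. factorized d \<zeta> \<eta> \<partial>\<mu>)"
        using integral_law[OF \<mu> t \<zeta>] stat t by (simp add: stationary_def)
      finally show ?thesis using True by (simp add: H_def)
    next
      case False
      \<comment> \<open>Started from another particle number, the dual process almost surely never
        has \<open>n\<close> particles at time \<open>t\<close>, so both sides are 0.\<close>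
      have "(\<integral>w. H (X' t w) \<partial>P' \<zeta>) = (\<integral>w. 0 \<partial>P' \<zeta>)"
        using conserved False by (intro integral_cong_AE discrete) (auto simp: H_def)
      then show ?thesis using False by (simp add: H_def)
    qed
  qed
  ultimately obtain \<psi> :: "nat \<Rightarrow> real" where "\<And>\<xi>. \<xi> \<in> finite_configs Ehat \<Longrightarrow> H \<xi> = \<psi> (particles \<xi>)"
    using triv unfolding bounded_harmonic_triviality_def by metis
  then have "H \<xi> = H \<zeta>" using \<xi> \<zeta> eq by simp
  then show ?thesis using eq by (simp add: H_def n_def)
qed

text \<open>The integral depends only on the particle number, so \<open>\<xi>\<close> may be
  replaced by \<open>\<zeta>\<close> with its particles on distinct sites. Under a product measure
  the integral for \<open>\<zeta>\<close> is a product of one-particle integrals.\<close>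

lemma moments_of_stationary_product:
  assumes inf: "infinite (UNIV :: 'a set)"
    and triv: "bounded_harmonic_triviality (finite_configs Ehat) P' X'"
    and \<mu>: "prob_space \<mu>" "sets \<mu> = sets (config_space E)"
    and stat: "stationary (config_space E) P X \<mu>" and prod: "product_measure E \<mu>"
    and \<xi>: "\<xi> \<in> finite_configs Ehat"
  shows "(\<integral>\<eta>. factorized d \<xi> \<eta> \<partial>\<mu>) = (\<integral>\<eta>. factorized d (delta_config x) \<eta> \<partial>\<mu>) ^ particles \<xi>"
proof -
  obtain \<nu> where \<nu>: "\<And>x. prob_space (\<nu> x)" "\<And>x. sets (\<nu> x) = sets (site_space E)"
    and \<mu>_eq: "\<mu> = PiM UNIV \<nu>"
    using prod unfolding product_measure_def by metis
  obtain F :: "'a set" where F: "finite F" "card F = particles \<xi>"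
    using infinite_arbitrarily_large[OF inf] by blast
  define \<zeta> where "\<zeta> y = (if y \<in> F then 1 else 0 :: nat)" for y
  have \<zeta>: "\<zeta> \<in> finite_configs Ehat"
    using F zero_mem one_mem by (auto simp: \<zeta>_def finite_configs_iff)
  have "particles \<zeta> = sum \<zeta> F"
    using F by (intro particles_eq_sum_superset) (auto simp: \<zeta>_def)
  also have "\<dots> = particles \<xi>" by (simp add: \<zeta>_def F)
  finally have "(\<integral>\<eta>. factorized d \<xi> \<eta> \<partial>\<mu>) = (\<integral>\<eta>. factorized d \<zeta> \<eta> \<partial>\<mu>)"
    by (intro stationary_integral_eq[OF triv \<mu> stat \<xi> \<zeta>]) simp
  also have "\<dots> = (\<Prod>y\<in>F. \<integral>s. d (\<zeta> y) s \<partial>\<nu> y)"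
    unfolding \<mu>_eq using F \<zeta> one_mem zero_mem by (intro integral_factorized_PiM \<nu>) (auto simp: \<zeta>_def)
  also have "\<dots> = (\<Prod>y\<in>F. \<integral>\<eta>. factorized d (delta_config x) \<eta> \<partial>\<mu>)"
  proof (rule prod.cong[OF refl])
    fix y assume "y \<in> F"
    \<comment> \<open>Constancy at particle number 1: the first moment is the same at every site,
      although the marginals are not known to agree.\<close>
    have "(\<integral>\<eta>. factorized d (pile 1 x) \<eta> \<partial>\<mu>) = (\<integral>\<eta>. factorized d (pile 1 y) \<eta> \<partial>\<mu>)"
      by (intro stationary_integral_eq[OF triv \<mu> stat] pile_mem one_mem) simp
    also have "\<dots> = (\<Prod>z\<in>{y}. \<integral>s. d (pile 1 y z) s \<partial>\<nu> z)"
      unfolding \<mu>_eq using one_mem zero_mem by (intro integral_factorized_PiM \<nu>) (auto simp: pile_def)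
    finally show "(\<integral>s. d (\<zeta> y) s \<partial>\<nu> y) = (\<integral>\<eta>. factorized d (delta_config x) \<eta> \<partial>\<mu>)"
      using \<open>y \<in> F\<close> unfolding delta_config_eq_pile by (simp add: \<zeta>_def pile_def)
  qed
  finally show ?thesis by (simp add: F)
qed

text \<open>By duality and conservation the law at time \<open>t\<close> has the same moments
  \<open>c ^ particles \<xi>\<close> as \<open>\<mu>\<close>, and these moments single out one
  product measure.\<close>

lemma stationary_product_of_moments:
  assumes det: "measure_determining Ehat E d"
    and \<mu>: "prob_space \<mu>" "sets \<mu> = sets (config_space E)"
    and moments: "\<And>\<xi>. \<xi> \<in> finite_configs Ehat \<Longrightarrow> (\<integral>\<eta>. factorized d \<xi> \<eta> \<partial>\<mu>) = c ^ particles \<xi>"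
  shows "stationary (config_space E) P X \<mu>" "product_measure E \<mu>"
proof -
  interpret prob_space \<mu> by fact
  \<comment> \<open>The marginal at an arbitrary site; \<open>undefined\<close> merely names one.
    Piles at that site give its moments \<open>c ^ k\<close>.\<close>
  define \<nu> where "\<nu> = distr \<mu> (site_space E) (\<lambda>\<eta>. \<eta> undefined)"
  have coord: "(\<lambda>\<eta>. \<eta> undefined) \<in> measurable \<mu> (site_space E)"
    using measurable_coordinate[of undefined E] by (simp add: measurable_cong_sets[OF \<mu>(2) refl])
  have \<nu>: "prob_space \<nu>" "sets \<nu> = sets (site_space E)"
    unfolding \<nu>_def by (auto intro: prob_space_distr coord)
  have \<nu>_moments: "(\<integral>s. d k s \<partial>\<nu>) = c ^ k" if k: "k \<in> Ehat" for k
  proof -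
    have "(\<integral>s. d k s \<partial>\<nu>) = (\<integral>\<eta>. d k (\<eta> undefined) \<partial>\<mu>)"
      unfolding \<nu>_def by (rule integral_distr[OF coord d_measurable[OF k]])
    also have "\<dots> = (\<integral>\<eta>. factorized d (pile k undefined) \<eta> \<partial>\<mu>)"
      using sets_eq_imp_space_eq[OF \<mu>(2)]
      by (intro Bochner_Integration.integral_cong) (auto simp: factorized_pile)
    finally show ?thesis using moments[OF pile_mem[OF k]] by simp
  qed
  have \<mu>_eq: "\<mu> = (\<Pi>\<^sub>M x\<in>UNIV. \<nu>)"
    by (rule eq_PiM_of_moments[OF det \<mu> \<nu> \<nu>_moments moments])
  then show "product_measure E \<mu>"
    using \<nu> unfolding product_measure_def by (intro exI[of _ "\<lambda>_. \<nu>"]) auto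
  show "stationary (config_space E) P X \<mu>"
    unfolding stationary_def
  proof (intro allI impI)
    fix t :: real assume "0 \<le> t"
    show "distr (\<mu> \<bind> P) (config_space E) (X t) = \<mu>"
    proof (cases "t = 0")
      case True
      then show ?thesis using distr_law_0[OF \<mu>] by simp
    next
      case False
      then have t: "0 < t" using \<open>0 \<le> t\<close> by simp
      let ?\<mu>t = "distr (\<mu> \<bind> P) (config_space E) (X t)"
      interpret L: prob_space "\<mu> \<bind> P" by (rule law_prob(2)[OF \<mu>])
      have pt: "prob_space ?\<mu>t"
        using X.coordinate[OF \<open>0 \<le> t\<close>]
        by (intro L.prob_space_distr) (simp add: measurable_cong_sets[OF law_prob(3)[OF \<mu>] refl])
      have "(\<integral>\<eta>. factorized d \<xi> \<eta> \<partial>?\<mu>t) = c ^ particles \<xi>" if \<xi>: "\<xi> \<in> finite_configs Ehat" for \<xi>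
      proof -
        interpret Q: prob_space "P' \<xi>" by (rule prob_P'[OF \<xi>])
        have X't: "X' t \<in> measurable (P' \<xi>) (count_space (finite_configs Ehat))"
          by (rule measurable_dual_coordinate[OF \<xi> \<open>0 \<le> t\<close>])
        have "(\<integral>\<eta>. factorized d \<xi> \<eta> \<partial>?\<mu>t) = (\<integral>w. (\<integral>\<eta>. factorized d (X' t w) \<eta> \<partial>\<mu>) \<partial>P' \<xi>)"
          by (rule integral_law[OF \<mu> t \<xi>])
        \<comment> \<open>The moment identity is applied to the random dual configuration at time
          \<open>t\<close>, which is always a finite configuration.\<close>
        also have "\<dots> = (\<integral>w. c ^ particles (X' t w) \<partial>P' \<xi>)"
          using measurable_space[OF X't]
          by (intro Bochner_Integration.integral_cong refl moments) simp
        also have "\<dots> = (\<integral>w. c ^ particles \<xi> \<partial>P' \<xi>)"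
        proof (rule integral_cong_AE)
          show "(\<lambda>w. c ^ particles (X' t w)) \<in> borel_measurable (P' \<xi>)"
            by (rule measurable_compose[OF X't]) simp
          have "AE w in P' \<xi>. particles (X' t w) = particles \<xi>"
            using conserves t \<xi> unfolding conserves_particles_def by simp
          then show "AE w in P' \<xi>. c ^ particles (X' t w) = c ^ particles \<xi>"
            by eventually_elim simp
        qed simp
        finally show ?thesis by (simp add: Q.prob_space)
      qed
      \<comment> \<open>The same \<open>c\<close> and the same \<open>\<nu>\<close> as for
        \<open>\<mu>\<close>, hence the same product measure.\<close>
      then have "?\<mu>t = (\<Pi>\<^sub>M x\<in>UNIV. \<nu>)"
        by (intro eq_PiM_of_moments[OF det pt _ \<nu> \<nu>_moments]) auto
      then show ?thesis using \<mu>_eq by simp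
    qed
  qed
qed

end

section \<open>The integer lattice and the equivalence\<close>

lemma infinite_int_vec: "infinite (UNIV :: (int ^ 'd) set)"
proof
  assume "finite (UNIV :: (int ^ 'd) set)"
  moreover have "inj (\<lambda>i :: int. (\<chi> j. i) :: int ^ 'd)"
    by (rule injI) (simp add: vec_eq_iff)
  ultimately show False
    using finite_imageD[of "\<lambda>i :: int. (\<chi> j. i) :: int ^ 'd" UNIV] finite_subset[OF subset_UNIV]
      infinite_UNIV_int by blast
qed

theorem theorem3p2:
  fixes E :: "real set" and Ehat :: "nat set" and d :: "nat \<Rightarrow> real \<Rightarrow> real"
    and W :: "'w measure" and P :: "(int ^ 'd \<Rightarrow> real) \<Rightarrow> 'w measure"
    and X :: "real \<Rightarrow> 'w \<Rightarrow> int ^ 'd \<Rightarrow> real"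
    and W' :: "'v measure" and P' :: "(int ^ 'd \<Rightarrow> nat) \<Rightarrow> 'v measure"
    and X' :: "real \<Rightarrow> 'v \<Rightarrow> int ^ 'd \<Rightarrow> nat"
    and \<mu> :: "(int ^ 'd \<Rightarrow> real) measure"
  assumes "E = \<nat> \<or> (\<exists>N::nat. N \<ge> 1 \<and> E = real ` {0..N}) \<or> E = {0..}"
    and "Ehat = UNIV \<or> (\<exists>N::nat. N \<ge> 1 \<and> Ehat = {0..N})"
    and "markov_process (config_space E) W P X"
    and "markov_process (count_space (finite_configs Ehat)) W' P' X'"
    and "\<forall>s\<in>E. d 0 s = 1"
    and "dual_processes (count_space (finite_configs Ehat)) P' X' (config_space E) P X (factorized d)"
    and "conserves_particles (finite_configs Ehat) P' X'"
    and "bounded_harmonic_triviality (finite_configs Ehat) P' X'"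
    and "prob_space \<mu>" and "sets \<mu> = sets (config_space E)"
    and "uniform_domination (finite_configs Ehat) \<mu> (factorized d)"
  shows "let a = (stationary (config_space E) P X \<mu> \<and> product_measure E \<mu>);
             b = (\<forall>\<xi>\<in>finite_configs Ehat. \<forall>x.
                    (\<integral>\<eta>. factorized d \<xi> \<eta> \<partial>\<mu>) =
                    (\<integral>\<eta>. factorized d (delta_config x) \<eta> \<partial>\<mu>) ^ particles \<xi>)
         in (a \<longrightarrow> b) \<and> (measure_determining Ehat E d \<longrightarrow> (a \<longleftrightarrow> b))"
proof -
  have mem: "0 \<in> Ehat" "1 \<in> Ehat" using assms(2) by auto
  have meas: "factorized d \<xi> \<in> borel_measurable (config_space E)"
    if "\<xi> \<in> finite_configs Ehat" for \<xi> :: "int ^ 'd \<Rightarrow> nat"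
    using assms(6) that unfolding dual_processes_def by simp
  \<comment> \<open>Measurability of \<open>D \<xi>\<close> comes with duality; domination over
    infinitely many sites adds boundedness of each \<open>d k\<close>.\<close>
  interpret bounded_factor E Ehat d
    by (rule bounded_factor_of_domination[OF infinite_int_vec mem _ meas assms(10,11)]) (use assms(5) in auto)
  interpret X: markov_process "config_space E" W P X by fact
  interpret X': markov_process "count_space (finite_configs Ehat)" W' P' X' by fact
  interpret factorized_duality E Ehat d W P X W' P' X'
    by unfold_locales (fact assms(6), fact assms(7))
  have ab: "(\<integral>\<eta>. factorized d \<xi> \<eta> \<partial>\<mu>) = (\<integral>\<eta>. factorized d (delta_config x) \<eta> \<partial>\<mu>) ^ particles \<xi>"
    if "stationary (config_space E) P X \<mu> \<and> product_measure E \<mu>" "\<xi> \<in> finite_configs Ehat" for \<xi> x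
    using moments_of_stationary_product[OF infinite_int_vec assms(8-10)] that by blast
  \<comment> \<open>The base \<open>c\<close> is the integral of \<open>D\<close> at
    \<open>delta_config x\<close> for any one fixed site \<open>x\<close>.\<close>
  have ba: "stationary (config_space E) P X \<mu> \<and> product_measure E \<mu>"
    if "measure_determining Ehat E d"
      and "\<forall>\<xi>\<in>finite_configs Ehat. \<forall>x. (\<integral>\<eta>. factorized d \<xi> \<eta> \<partial>\<mu>) =
        (\<integral>\<eta>. factorized d (delta_config x) \<eta> \<partial>\<mu>) ^ particles \<xi>"
    using stationary_product_of_moments[OF that(1) assms(9,10)] that(2) by blast
  show ?thesis unfolding Let_def using ab ba by blast
qed

end
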